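(* Let $r,s$ be non-negative integers and $n,k,\lambda$ positive integers with $\max\{r,s\}\le n\le k$. Let $\boldsymbol\rho=(\rho_1,\dots,\rho_k)$ be a $k$-tuple of integers with $1\le\rho_\ell\le\lambda n$ for each $\ell\in[k]$ and $\sum_{\ell\in[k]}\rho_\ell=\lambda n^2$. A simple $r\times s$ $(\boldsymbol\rho,\lambda)$-Latin rectangle $M$ can be extended to a simple $n\times n$ $(\boldsymbol\rho,\lambda)$-Latin square if and only if $M$ is simply admissible.
   Context: Notation: $[m]=\{1,\dots,m\}$ (so $[0]=\varnothing$); $x\,\dot{-}\,y:=\max\{0,x-y\}$; for $K\subseteq[k]$, $\bar K=[k]\setminus K$. Arrays: an $r\times s$ $\lambda$-matrix $M$ on the symbol set $[k]$ is an $r\times s$ array in which each cell $(i,j)$ contains a multiset of exactly $\lambda$ elements of $[k]$. For $\ell\in[k]$, $i\in[r]$, $j\in[s]$, write $|M_\ell|$, $|M^i_\ell|$, $|{}^jM_\ell|$ for the number of occurrences (with multiplicity) of $\ell$ in $M$, in row $i$ of $M$, and in column $j$ of $M$, respectively. An $n\times n$ $(\boldsymbol\rho,\lambda)$-Latin square is an $n\times n$ $\lambda$-matrix $N$ on $[k]$ with $|N_\ell|=\rho_\ell$, $|N^i_\ell|\le\lambda$, $|{}^jN_\ell|\le\lambda$ for all $\ell\in[k]$, $i,j\in[n]$. An $r\times s$ $(\boldsymbol\rho,\lambda)$-Latin rectangle is an $r\times s$ $\lambda$-matrix $M$ on $[k]$ with $|M_\ell|\le\rho_\ell$, $|M^i_\ell|\le\lambda$,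 $|{}^jM_\ell|\le\lambda$ for all $\ell\in[k]$, $i\in[r]$, $j\in[s]$. Such a square or rectangle is simple if each symbol occurs at most once in each cell. $M$ is extended to $N$ if $M$ is the top left $r\times s$ subarray of $N$. Simple admissibility: given a simple $r\times s$ $(\boldsymbol\rho,\lambda)$-Latin rectangle $M$, put, for $\ell\in[k]$, $$\alpha_\ell:=(\rho_\ell-|M_\ell|+\lambda r)\,\dot{-}\,\lambda n,\qquad \beta_\ell:=(\rho_\ell-|M_\ell|+\lambda s)\,\dot{-}\,\lambda n.$$ $M$ is simply admissible if $\lambda\le k$ and there exists a sequence $\{(a_\ell,b_\ell)\}_{\ell=1}^k$ of pairs of non-negative integers such that all of the following hold: (1) $\sum_{\ell\in[k]}a_\ell=\lambda r(n-s)-\sum_{\ell\in[k]}\alpha_\ell$; (2) $\sum_{\ell\in[k]}b_\ell=\lambda s(n-r)-\sum_{\ell\in[k]}\beta_\ell$; (3) $a_\ell\le\sum_{i\in[r]}\min\{n-s,\lambda-|M^i_\ell|\}-\alpha_\ell$ for all $\ell\in[k]$; (4) $b_\ell\le\sum_{j\in[s]}\min\{n-r,\lambda-|{}^jM_\ell|\}-\beta_\ell$ for all $\ell\in[k]$; (5) $a_\ell+b_\ell\le\rho_\ell-|M_\ell|-\alpha_\ell-\beta_\ell$ for all $\ell\in[k]$; (6) $a_\ell+b_\ell\ge\rho_\ell-|M_\ell|-\alpha_\ell-\beta_\ell-(n-r)(n-s)$ for all $\ell\in[k]$; (7) $\lambda(n-s)\le\sum_{\ell\in[k]}\min\{n-s,\lambda-|M^i_\ell|\}$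 for all $i\in[r]$; (8) $\lambda(n-r)\le\sum_{\ell\in[k]}\min\{n-r,\lambda-|{}^jM_\ell|\}$ for all $j\in[s]$; (9) $\sum_{i\in[r]}\Big(\lambda(n-s)\,\dot{-}\,\sum_{\ell\in K}\min\{n-s,\lambda-|M^i_\ell|\}\Big)\le\sum_{\ell\in\bar K}(a_\ell+\alpha_\ell)$ for all $K\subseteq[k]$; (10) $\sum_{j\in[s]}\Big(\lambda(n-r)\,\dot{-}\,\sum_{\ell\in K}\min\{n-r,\lambda-|{}^jM_\ell|\}\Big)\le\sum_{\ell\in\bar K}(b_\ell+\beta_\ell)$ for all $K\subseteq[k]$. *)

theory Defs
  imports "HOL-Library.Multiset"
begin

text \<open>
  Rows, columns and symbols are numbered from 1. An \<open>r \<times> s\<close> array is a function of which only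
  the values at \<open>{1..r} \<times> {1..s}\<close> matter; the dimensions are therefore explicit arguments
  below. The parameter \<open>\<lambda>\<close> of the mathematical text is written \<open>lam\<close>. Quantities that
  involve subtraction are computed in \<^typ>\<open>int\<close>.
\<close>

type_synonym arr = "nat \<Rightarrow> nat \<Rightarrow> nat multiset"

definition lambda_matrix :: "nat \<Rightarrow> nat \<Rightarrow> nat \<Rightarrow> nat \<Rightarrow> arr \<Rightarrow> bool" where
  "lambda_matrix r s k lam M \<longleftrightarrow>
     (\<forall>i\<in>{1..r}. \<forall>j\<in>{1..s}. size (M i j) = lam \<and> set_mset (M i j) \<subseteq> {1..k})"

definition row_occ :: "nat \<Rightarrow> arr \<Rightarrow> nat \<Rightarrow> nat \<Rightarrow> nat" where
  "row_occ s M i l = (\<Sum>j\<in>{1..s}. count (M i j) l)"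

definition col_occ :: "nat \<Rightarrow> arr \<Rightarrow> nat \<Rightarrow> nat \<Rightarrow> nat" where
  "col_occ r M j l = (\<Sum>i\<in>{1..r}. count (M i j) l)"

definition occ :: "nat \<Rightarrow> nat \<Rightarrow> arr \<Rightarrow> nat \<Rightarrow> nat" where
  "occ r s M l = (\<Sum>i\<in>{1..r}. \<Sum>j\<in>{1..s}. count (M i j) l)"

definition latin_square :: "nat \<Rightarrow> nat \<Rightarrow> (nat \<Rightarrow> int) \<Rightarrow> nat \<Rightarrow> arr \<Rightarrow> bool" where
  "latin_square n k rho lam N \<longleftrightarrow>
     lambda_matrix n n k lam N \<and>
     (\<forall>l\<in>{1..k}. int (occ n n N l) = rho l \<and>
        (\<forall>i\<in>{1..n}. row_occ n N i l \<le> lam) \<and>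
        (\<forall>j\<in>{1..n}. col_occ n N j l \<le> lam))"

definition latin_rectangle ::
    "nat \<Rightarrow> nat \<Rightarrow> nat \<Rightarrow> (nat \<Rightarrow> int) \<Rightarrow> nat \<Rightarrow> arr \<Rightarrow> bool" where
  "latin_rectangle r s k rho lam M \<longleftrightarrow>
     lambda_matrix r s k lam M \<and>
     (\<forall>l\<in>{1..k}. int (occ r s M l) \<le> rho l \<and>
        (\<forall>i\<in>{1..r}. row_occ s M i l \<le> lam) \<and>
        (\<forall>j\<in>{1..s}. col_occ r M j l \<le> lam))"

definition simple_array :: "nat \<Rightarrow> nat \<Rightarrow> nat \<Rightarrow> arr \<Rightarrow> bool" where
  "simple_array r s k M \<longleftrightarrow>
     (\<forall>i\<in>{1..r}. \<forall>j\<in>{1..s}. \<forall>l\<in>{1..k}. count (M i j) l \<le> 1)"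

definition extends_to :: "nat \<Rightarrow> nat \<Rightarrow> arr \<Rightarrow> arr \<Rightarrow> bool" where
  "extends_to r s M N \<longleftrightarrow> (\<forall>i\<in>{1..r}. \<forall>j\<in>{1..s}. N i j = M i j)"

definition monus :: "int \<Rightarrow> int \<Rightarrow> int" where
  "monus x y = max 0 (x - y)"

definition alpha ::
    "nat \<Rightarrow> nat \<Rightarrow> nat \<Rightarrow> (nat \<Rightarrow> int) \<Rightarrow> nat \<Rightarrow> arr \<Rightarrow> nat \<Rightarrow> int" where
  "alpha r s n rho lam M l =
     monus (rho l - int (occ r s M l) + int lam * int r) (int lam * int n)"

definition beta ::
    "nat \<Rightarrow> nat \<Rightarrow> nat \<Rightarrow> (nat \<Rightarrow> int) \<Rightarrow> nat \<Rightarrow> arr \<Rightarrow> nat \<Rightarrow> int" where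
  "beta r s n rho lam M l =
     monus (rho l - int (occ r s M l) + int lam * int s) (int lam * int n)"

text \<open>
  The terms \<open>min {n - s, \<lambda> - |M\<^sup>i\<^sub>l|}\<close> and \<open>min {n - r, \<lambda> - |\<^sup>jM\<^sub>l|}\<close>.
\<close>

definition row_cap :: "nat \<Rightarrow> nat \<Rightarrow> nat \<Rightarrow> arr \<Rightarrow> nat \<Rightarrow> nat \<Rightarrow> int" where
  "row_cap s n lam M i l = min (int n - int s) (int lam - int (row_occ s M i l))"

definition col_cap :: "nat \<Rightarrow> nat \<Rightarrow> nat \<Rightarrow> arr \<Rightarrow> nat \<Rightarrow> nat \<Rightarrow> int" where
  "col_cap r n lam M j l = min (int n - int r) (int lam - int (col_occ r M j l))"

definition simply_admissible ::
    "nat \<Rightarrow> nat \<Rightarrow> nat \<Rightarrow> nat \<Rightarrow> (nat \<Rightarrow> int) \<Rightarrow> nat \<Rightarrow> arr \<Rightarrow> bool" where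
  "simply_admissible r s n k rho lam M \<longleftrightarrow>
     lam \<le> k \<and>
     (\<exists>(a :: nat \<Rightarrow> nat) (b :: nat \<Rightarrow> nat).
        (\<Sum>l\<in>{1..k}. int (a l)) =
          int lam * int r * (int n - int s) - (\<Sum>l\<in>{1..k}. alpha r s n rho lam M l) \<and>
        (\<Sum>l\<in>{1..k}. int (b l)) =
          int lam * int s * (int n - int r) - (\<Sum>l\<in>{1..k}. beta r s n rho lam M l) \<and>
        (\<forall>l\<in>{1..k}. int (a l) \<le>
          (\<Sum>i\<in>{1..r}. row_cap s n lam M i l) - alpha r s n rho lam M l) \<and>
        (\<forall>l\<in>{1..k}. int (b l) \<le>
          (\<Sum>j\<in>{1..s}. col_cap r n lam M j l) - beta r s n rho lam M l) \<and>
        (\<forall>l\<in>{1..k}. int (a l) + int (b l) \<le>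
          rho l - int (occ r s M l) - alpha r s n rho lam M l - beta r s n rho lam M l) \<and>
        (\<forall>l\<in>{1..k}. int (a l) + int (b l) \<ge>
          rho l - int (occ r s M l) - alpha r s n rho lam M l - beta r s n rho lam M l
            - (int n - int r) * (int n - int s)) \<and>
        (\<forall>i\<in>{1..r}. int lam * (int n - int s) \<le> (\<Sum>l\<in>{1..k}. row_cap s n lam M i l)) \<and>
        (\<forall>j\<in>{1..s}. int lam * (int n - int r) \<le> (\<Sum>l\<in>{1..k}. col_cap r n lam M j l)) \<and>
        (\<forall>K. K \<subseteq> {1..k} \<longrightarrow>
          (\<Sum>i\<in>{1..r}. monus (int lam * (int n - int s)) (\<Sum>l\<in>K. row_cap s n lam M i l))
            \<le> (\<Sum>l\<in>{1..k} - K. int (a l) + alpha r s n rho lam M l)) \<and>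
        (\<forall>K. K \<subseteq> {1..k} \<longrightarrow>
          (\<Sum>j\<in>{1..s}. monus (int lam * (int n - int r)) (\<Sum>l\<in>K. col_cap r n lam M j l))
            \<le> (\<Sum>l\<in>{1..k} - K. int (b l) + beta r s n rho lam M l)))"

end

theory Submission
  imports Defs
begin

text \<open>
  An \<open>n \<times> n\<close> square containing \<open>M\<close> in its top left corner has three further blocks: top right,
  bottom left and bottom right. Forget how a symbol is spread over the columns of the top right
  block, over the rows of the bottom left block, and over both in the bottom right block. What is
  left is an \<open>outline\<close>: numbers \<open>y i l\<close> (symbol \<open>l\<close> in row \<open>i\<close> of the top right block), \<open>z j l\<close>
  (symbol \<open>l\<close> in column \<open>j\<close> of the bottom left block) and \<open>D l\<close> (symbol \<open>l\<close> in the bottom right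
  block). The theorem is the composition of two equivalences.

  A square extending \<open>M\<close> exists if and only if an outline exists. Counting in the square gives an
  outline (\<open>outline_of_square\<close>). Conversely, the forgotten columns are one merged column, in which
  the multiplicities of the symbols form a bipartite multigraph between the rows (all the bottom
  rows being merged into one row) and the symbols. Splitting its edges into \<open>n - s\<close> classes that
  share the edges at each row, at each symbol and at each row-symbol pair fairly separates the
  columns; a second splitting separates the bottom rows (\<open>square_of_outline\<close>). Fairness at the pairs
  is what keeps the square simple.

  An outline exists if and only if \<open>M\<close> is simply admissible. The numbers \<open>a l + \<alpha> l\<close> and
  \<open>b l + \<beta> l\<close> of the definition are the symbol totals of the top right and the bottom left block;
  \<open>\<alpha> l\<close> is what symbol \<open>l\<close> must place in the top right block since the \<open>n - r\<close> bottom rows take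
  at most \<open>\<lambda> (n - r)\<close> copies of it, and \<open>\<beta> l\<close> is its analogue. Given these totals, finding \<open>y\<close> is
  an integral transportation problem with capacities, and the conditions over all sets \<open>K\<close> of
  symbols say that no cut obstructs it; the same holds for \<open>z\<close>.

  Both halves rest on one fact, the cut criterion for integral capacitated transport
  (\<open>capacitated_transport\<close>). It settles the second equivalence directly, and it yields the fair
  splittings because dividing all multiplicities by the number of classes is a fractional solution
  of the problem of extracting one class (\<open>integral_rounding\<close>, \<open>equitable_split\<close>).
\<close>

(* Keeps intervals in the form {1..n} instead of {Suc 0..n}. *)
declare One_nat_def [simp del]

section \<open>Integral transport with capacities\<close>

text \<open>
  The amount by which a cut exceeds the demand it has to carry: rows in \<open>I\<close> demand \<open>R\<close>, and they
  can reach columns in \<open>K\<close> only through the capacities, while columns outside \<open>K\<close> accept at most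
  \<open>A\<close>. Membership is expressed by indicators, so that \<open>I\<close> and \<open>K\<close> range over arbitrary sets and
  identities between slacks can be checked term by term.
\<close>
definition slack :: "'a set \<Rightarrow> 'b set \<Rightarrow> ('a \<Rightarrow> 'b \<Rightarrow> int) \<Rightarrow> ('a \<Rightarrow> int) \<Rightarrow>
    ('b \<Rightarrow> int) \<Rightarrow> 'a set \<Rightarrow> 'b set \<Rightarrow> int" where
  "slack U V cap R A I K =
     (\<Sum>u\<in>U. \<Sum>v\<in>V. cap u v * of_bool (u \<in> I \<and> v \<in> K))
     + (\<Sum>v\<in>V. A v * of_bool (v \<notin> K)) - (\<Sum>u\<in>U. R u * of_bool (u \<in> I))"

text \<open>
  The usual submodularity of cut functions, where \<open>I\<close> together with the complement of \<open>K\<close> is one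
  side of the cut: hence intersection on one coordinate goes with union on the other.
\<close>
lemma slack_submodular:
  assumes "\<And>u v. u \<in> U \<Longrightarrow> v \<in> V \<Longrightarrow> 0 \<le> cap u v"
  shows "slack U V cap R A (I \<inter> I') (K \<union> K') + slack U V cap R A (I \<union> I') (K \<inter> K')
         \<le> slack U V cap R A I K + slack U V cap R A I' K'"
proof -
  have 1: "(\<Sum>u\<in>U. \<Sum>v\<in>V. cap u v * of_bool (u \<in> I \<inter> I' \<and> v \<in> K \<union> K'))
         + (\<Sum>u\<in>U. \<Sum>v\<in>V. cap u v * of_bool (u \<in> I \<union> I' \<and> v \<in> K \<inter> K'))
       \<le> (\<Sum>u\<in>U. \<Sum>v\<in>V. cap u v * of_bool (u \<in> I \<and> v \<in> K))
         + (\<Sum>u\<in>U. \<Sum>v\<in>V. cap u v * of_bool (u \<in> I' \<and> v \<in> K'))"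
    unfolding sum.distrib [symmetric]
    by (intro sum_mono) (use assms in \<open>auto simp: of_bool_def\<close>)
  have 2: "(\<Sum>v\<in>V. A v * of_bool (v \<notin> K \<union> K')) + (\<Sum>v\<in>V. A v * of_bool (v \<notin> K \<inter> K'))
       = (\<Sum>v\<in>V. A v * of_bool (v \<notin> K)) + (\<Sum>v\<in>V. A v * of_bool (v \<notin> K'))"
    unfolding sum.distrib [symmetric] by (intro sum.cong) auto
  have 3: "(\<Sum>u\<in>U. R u * of_bool (u \<in> I \<inter> I')) + (\<Sum>u\<in>U. R u * of_bool (u \<in> I \<union> I'))
       = (\<Sum>u\<in>U. R u * of_bool (u \<in> I)) + (\<Sum>u\<in>U. R u * of_bool (u \<in> I'))"
    unfolding sum.distrib [symmetric] by (intro sum.cong) auto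
  show ?thesis using 1 2 3 unfolding slack_def by linarith
qed

lemma slack_eq:
  assumes "finite U" "finite V" "I \<subseteq> U" "K \<subseteq> V"
  shows "slack U V cap R A I K =
    (\<Sum>u\<in>I. \<Sum>v\<in>K. cap u v) + (\<Sum>v\<in>V - K. A v) - (\<Sum>u\<in>I. R u)"
proof -
  have "(\<Sum>u\<in>U. \<Sum>v\<in>V. cap u v * of_bool (u \<in> I \<and> v \<in> K))
      = (\<Sum>u\<in>U. (\<Sum>v\<in>V. cap u v * of_bool (v \<in> K)) * of_bool (u \<in> I))"
    by (intro sum.cong refl) (auto simp: of_bool_def)
  moreover have "U \<inter> I = I" "V \<inter> K = K" "V \<inter> {v. v \<notin> K} = V - K"
    using assms by auto
  ultimately show ?thesis
    using assms(1,2) by (simp add: slack_def)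
qed

lemma slack_remove_row:
  assumes "finite U" "u \<in> U" "u \<in> I" "\<And>v. v \<in> V \<Longrightarrow> v \<notin> K \<Longrightarrow> cap u v = 0"
  shows "slack U V cap R A (I - {u}) K = slack U V cap R A I K - (\<Sum>v\<in>V. cap u v) + R u"
proof -
  have "(\<Sum>v\<in>V. cap u v * of_bool (v \<in> K)) = (\<Sum>v\<in>V. cap u v)"
    using assms(4) by (intro sum.cong) auto
  moreover have "(\<Sum>w\<in>U - {u}. \<Sum>v\<in>V. cap w v * of_bool (w \<in> I - {u} \<and> v \<in> K))
      = (\<Sum>w\<in>U - {u}. \<Sum>v\<in>V. cap w v * of_bool (w \<in> I \<and> v \<in> K))"
    by (intro sum.cong) auto
  moreover have "(\<Sum>w\<in>U - {u}. R w * of_bool (w \<in> I - {u})) = (\<Sum>w\<in>U - {u}. R w * of_bool (w \<in> I))"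
    by (intro sum.cong) auto
  ultimately show ?thesis
    using assms(1-3) by (simp add: slack_def sum.remove [of U u] del: sum_mult_of_bool_eq)
qed

lemma slack_remove_column:
  assumes "finite V" "v \<in> V" "v \<in> K" "\<And>u. u \<in> U \<Longrightarrow> u \<notin> I \<Longrightarrow> cap u v = 0"
  shows "slack U V cap R A I (K - {v}) = slack U V cap R A I K - (\<Sum>u\<in>U. cap u v) + A v"
proof -
  have "(\<Sum>u\<in>U. cap u v * of_bool (u \<in> I)) = (\<Sum>u\<in>U. cap u v)"
    using assms(4) by (intro sum.cong) auto
  moreover have "(\<Sum>u\<in>U. \<Sum>w\<in>V - {v}. cap u w * of_bool (u \<in> I \<and> w \<in> K - {v}))
      = (\<Sum>u\<in>U. \<Sum>w\<in>V - {v}. cap u w * of_bool (u \<in> I \<and> w \<in> K))"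
    by (intro sum.cong) auto
  moreover have "(\<Sum>w\<in>V - {v}. A w * of_bool (w \<notin> K - {v})) = (\<Sum>w\<in>V - {v}. A w * of_bool (w \<notin> K))"
    by (intro sum.cong) auto
  ultimately show ?thesis
    using assms(1-3) by (simp add: slack_def sum.remove [of V v] sum.distrib del: sum_mult_of_bool_eq)
qed

lemma slack_decrease:
  assumes "finite U" "finite V" "u0 \<in> U" "v0 \<in> V"
  shows "slack U V (\<lambda>u v. cap u v - of_bool (u = u0 \<and> v = v0)) R A I K
       = slack U V cap R A I K - of_bool (u0 \<in> I \<and> v0 \<in> K)"
proof -
  have "(\<Sum>u\<in>U. \<Sum>v\<in>V. of_bool (u = u0 \<and> v = v0) * of_bool (u \<in> I \<and> v \<in> K))
      = (\<Sum>u\<in>U. \<Sum>v\<in>V. if v = v0 then if u = u0 then of_bool (u0 \<in> I \<and> v0 \<in> K) else 0 else (0::int))"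
    by (intro sum.cong refl) auto
  also have "\<dots> = of_bool (u0 \<in> I \<and> v0 \<in> K)"
    using assms by simp
  finally show ?thesis
    by (simp add: slack_def left_diff_distrib sum_subtractf del: sum_mult_of_bool_eq sum_of_bool_mult_eq)
qed

text \<open>
  If every positive capacity lies in a cut of slack 0, then the capacities themselves are the
  required transport. Tight cuts can be uncrossed by submodularity, so for a row \<open>u\<close> there is one
  tight cut \<open>(I, K)\<close> with \<open>u \<in> I\<close> and all positive capacities of \<open>u\<close> inside \<open>K\<close>. Removing \<open>u\<close> from
  \<open>I\<close> cannot make the slack negative, which bounds the capacity of the row by \<open>R u\<close>. Columns are
  dual.
\<close>
lemma saturated_rows_cols:
  assumes fin: "finite U" "finite V"
    and nonneg: "\<And>u v. u \<in> U \<Longrightarrow> v \<in> V \<Longrightarrow> 0 \<le> cap u v"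
    and total: "sum R U = sum A V"
    and cut: "\<And>I K. 0 \<le> slack U V cap R A I K"
    and tight: "\<And>u v. u \<in> U \<Longrightarrow> v \<in> V \<Longrightarrow> 0 < cap u v \<Longrightarrow>
                  \<exists>I K. u \<in> I \<and> v \<in> K \<and> slack U V cap R A I K = 0"
  shows "\<forall>u\<in>U. (\<Sum>v\<in>V. cap u v) = R u" and "\<forall>v\<in>V. (\<Sum>u\<in>U. cap u v) = A v"
proof -
  let ?s = "slack U V cap R A"
  have uncross: "?s (I \<inter> I') (K \<union> K') = 0" "?s (I \<union> I') (K \<inter> K') = 0"
    if "?s I K = 0" "?s I' K' = 0" for I I' K K'
    using slack_submodular [of U V cap R A I I' K K'] nonneg that
      cut [of "I \<inter> I'" "K \<union> K'"] cut [of "I \<union> I'" "K \<inter> K'"] by auto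
  have base: "?s U {} = 0" "?s {} V = 0"
    using total fin by (auto simp: slack_eq)
  have row_le: "(\<Sum>v\<in>V. cap u v) \<le> R u" if u: "u \<in> U" for u
  proof -
    have "\<exists>I K. u \<in> I \<and> X \<subseteq> K \<and> ?s I K = 0" if "finite X" "X \<subseteq> {v\<in>V. 0 < cap u v}" for X
      using that
    proof (induction X)
      case empty
      then show ?case using base(1) u by blast
    next
      case (insert v X)
      then obtain I K where "u \<in> I" "X \<subseteq> K" "?s I K = 0" by auto
      moreover obtain I' K' where "u \<in> I'" "v \<in> K'" "?s I' K' = 0"
        using tight [of u v] u insert.prems by auto
      ultimately show ?case
        using uncross(1) [of I K I' K'] by (intro exI [of _ "I \<inter> I'"] exI [of _ "K \<union> K'"]) auto
    qed
    from this [of "{v\<in>V. 0 < cap u v}"] obtain I K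
      where IK: "u \<in> I" "{v\<in>V. 0 < cap u v} \<subseteq> K" "?s I K = 0"
      using fin by auto
    have "cap u v = 0" if "v \<in> V" "v \<notin> K" for v
      using IK(2) nonneg [OF u that(1)] that by force
    then show ?thesis
      using slack_remove_row [OF fin(1) u IK(1), of V K cap R A] IK(3) cut [of "I - {u}" K] by simp
  qed
  have col_le: "(\<Sum>u\<in>U. cap u v) \<le> A v" if v: "v \<in> V" for v
  proof -
    have "\<exists>I K. v \<in> K \<and> X \<subseteq> I \<and> ?s I K = 0" if "finite X" "X \<subseteq> {u\<in>U. 0 < cap u v}" for X
      using that
    proof (induction X)
      case empty
      then show ?case using base(2) v by blast
    next
      case (insert u X)
      then obtain I K where "v \<in> K" "X \<subseteq> I" "?s I K = 0" by auto
      moreover obtain I' K' where "u \<in> I'" "v \<in> K'" "?s I' K' = 0"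
        using tight [of u v] v insert.prems by auto
      ultimately show ?case
        using uncross(2) [of I K I' K'] by (intro exI [of _ "I \<union> I'"] exI [of _ "K \<inter> K'"]) auto
    qed
    from this [of "{u\<in>U. 0 < cap u v}"] obtain I K
      where IK: "v \<in> K" "{u\<in>U. 0 < cap u v} \<subseteq> I" "?s I K = 0"
      using fin by auto
    have "cap u v = 0" if "u \<in> U" "u \<notin> I" for u
      using IK(2) nonneg [OF that(1) v] that by force
    then show ?thesis
      using slack_remove_column [OF fin(2) v IK(1), of U I cap R A] IK(3) cut [of I "K - {v}"] by simp
  qed
  \<comment> \<open>All columns together form a cut for the single row \<open>u\<close>.\<close>
  have row_ge: "R u \<le> (\<Sum>v\<in>V. cap u v)" if u: "u \<in> U" for u
    using cut [of "{u}" V] u fin by (simp add: slack_eq)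
  show rows: "\<forall>u\<in>U. (\<Sum>v\<in>V. cap u v) = R u"
    using row_le row_ge by force
  \<comment> \<open>Equal totals turn the upper bounds on the columns into equalities.\<close>
  have "(\<Sum>v\<in>V. A v - (\<Sum>u\<in>U. cap u v)) = 0"
    using rows total sum.swap [of "\<lambda>u v. cap u v" V U] by (simp add: sum_subtractf)
  then show "\<forall>v\<in>V. (\<Sum>u\<in>U. cap u v) = A v"
    using col_le fin(2) by (subst (asm) sum_nonneg_eq_0_iff) auto
qed

text \<open>
  The cut criterion. As long as some positive capacity lies in no tight cut it can be lowered by 1
  without violating the criterion, because slacks are integers; when this process stops,
  \<open>saturated_rows_cols\<close> applies.
\<close>
lemma capacitated_transport:
  fixes U :: "'a set" and V :: "'b set" and cap :: "'a \<Rightarrow> 'b \<Rightarrow> int"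
  assumes fin: "finite U" "finite V"
    and nonneg: "\<And>u v. u \<in> U \<Longrightarrow> v \<in> V \<Longrightarrow> 0 \<le> cap u v"
    and total: "sum R U = sum A V"
    and cut: "\<And>I K. I \<subseteq> U \<Longrightarrow> K \<subseteq> V \<Longrightarrow>
                sum R I \<le> (\<Sum>u\<in>I. \<Sum>v\<in>K. cap u v) + sum A (V - K)"
  shows "\<exists>f. (\<forall>u\<in>U. \<forall>v\<in>V. 0 \<le> f u v \<and> f u v \<le> cap u v) \<and>
             (\<forall>u\<in>U. (\<Sum>v\<in>V. f u v) = R u) \<and> (\<forall>v\<in>V. (\<Sum>u\<in>U. f u v) = A v)"
proof -
  have "0 \<le> slack U V cap R A I K" for I K
  proof -
    have "slack U V cap R A I K = slack U V cap R A (I \<inter> U) (K \<inter> V)"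
      unfolding slack_def by (intro arg_cong2 [where f = "(-)"] arg_cong2 [where f = "(+)"] sum.cong) auto
    then show ?thesis using cut [of "I \<inter> U" "K \<inter> V"] fin by (simp add: slack_eq)
  qed
  with nonneg show ?thesis
  proof (induction "nat (\<Sum>u\<in>U. \<Sum>v\<in>V. cap u v)" arbitrary: cap rule: less_induct)
    case less
    show ?case
    proof (cases "\<forall>u\<in>U. \<forall>v\<in>V. 0 < cap u v \<longrightarrow> (\<exists>I K. u \<in> I \<and> v \<in> K \<and> slack U V cap R A I K = 0)")
      case True
      then have "\<forall>u\<in>U. (\<Sum>v\<in>V. cap u v) = R u" "\<forall>v\<in>V. (\<Sum>u\<in>U. cap u v) = A v"
        using saturated_rows_cols [OF fin less.prems(1) total less.prems(2)] by blast+
      then show ?thesis using less.prems(1) by (intro exI [of _ cap]) auto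
    next
      case False
      then obtain u0 v0 where uv: "u0 \<in> U" "v0 \<in> V" "0 < cap u0 v0"
        and loose: "\<And>I K. u0 \<in> I \<Longrightarrow> v0 \<in> K \<Longrightarrow> slack U V cap R A I K \<noteq> 0" by blast
      define cap' where "cap' = (\<lambda>u v. cap u v - of_bool (u = u0 \<and> v = v0))"
      have nonneg': "0 \<le> cap' u v" if "u \<in> U" "v \<in> V" for u v
        using less.prems(1) [OF that] uv(3) by (auto simp: cap'_def)
      have cut': "0 \<le> slack U V cap' R A I K" for I K
        using loose [of I K] less.prems(2) [of I K] slack_decrease [OF fin uv(1,2), of cap R A I K]
        by (auto simp: cap'_def of_bool_def split: if_splits)
      have "(\<Sum>u\<in>U. \<Sum>v\<in>V. cap' u v) < (\<Sum>u\<in>U. \<Sum>v\<in>V. cap u v)"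
      proof (rule sum_strict_mono_ex1)
        show "\<exists>u\<in>U. (\<Sum>v\<in>V. cap' u v) < (\<Sum>v\<in>V. cap u v)"
          using uv fin by (intro bexI [of _ u0] sum_strict_mono_ex1) (auto simp: cap'_def)
      qed (use fin in \<open>auto simp: cap'_def intro!: sum_mono\<close>)
      moreover have "0 \<le> (\<Sum>u\<in>U. \<Sum>v\<in>V. cap' u v)"
        using nonneg' by (intro sum_nonneg) auto
      ultimately have "nat (\<Sum>u\<in>U. \<Sum>v\<in>V. cap' u v) < nat (\<Sum>u\<in>U. \<Sum>v\<in>V. cap u v)" by linarith
      from less.hyps [OF this nonneg' cut']
      obtain f where "\<forall>u\<in>U. \<forall>v\<in>V. 0 \<le> f u v \<and> f u v \<le> cap' u v"
        "\<forall>u\<in>U. (\<Sum>v\<in>V. f u v) = R u" "\<forall>v\<in>V. (\<Sum>u\<in>U. f u v) = A v" by blast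
      moreover have "cap' u v \<le> cap u v" for u v by (simp add: cap'_def)
      ultimately show ?thesis by (intro exI [of _ f]) (meson order_trans)
    qed
  qed
qed

text \<open>
  Integrality: here \<open>g / c\<close> is a rational transport between the bounds \<open>L\<close> and \<open>H\<close>, and it can be
  replaced by an integral one with the same row and column sums. After subtracting the lower bound,
  the existence of \<open>g\<close> proves every cut inequality multiplied by \<open>c\<close>.
\<close>
lemma integral_rounding:
  fixes U :: "'a set" and V :: "'b set" and g L H :: "'a \<Rightarrow> 'b \<Rightarrow> int" and c :: int
  assumes fin: "finite U" "finite V" and c: "0 < c"
    and bounds: "\<And>u v. u \<in> U \<Longrightarrow> v \<in> V \<Longrightarrow> c * L u v \<le> g u v \<and> g u v \<le> c * H u v"
    and rows: "\<And>u. u \<in> U \<Longrightarrow> (\<Sum>v\<in>V. g u v) = c * R u"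
    and cols: "\<And>v. v \<in> V \<Longrightarrow> (\<Sum>u\<in>U. g u v) = c * A v"
  shows "\<exists>f. (\<forall>u\<in>U. \<forall>v\<in>V. L u v \<le> f u v \<and> f u v \<le> H u v) \<and>
             (\<forall>u\<in>U. (\<Sum>v\<in>V. f u v) = R u) \<and> (\<forall>v\<in>V. (\<Sum>u\<in>U. f u v) = A v)"
proof -
  define d where "d u v = g u v - c * L u v" for u v
  have drow: "(\<Sum>v\<in>V. d u v) = c * (R u - (\<Sum>v\<in>V. L u v))" if "u \<in> U" for u
    using rows [OF that] by (simp add: d_def sum_subtractf right_diff_distrib sum_distrib_left)
  have dcol: "(\<Sum>u\<in>U. d u v) = c * (A v - (\<Sum>u\<in>U. L u v))" if "v \<in> V" for v
    using cols [OF that] by (simp add: d_def sum_subtractf right_diff_distrib sum_distrib_left)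
  have d: "0 \<le> d u v" "d u v \<le> c * (H u v - L u v)" if "u \<in> U" "v \<in> V" for u v
    using bounds [OF that] by (auto simp: d_def right_diff_distrib)
  have "\<exists>f. (\<forall>u\<in>U. \<forall>v\<in>V. 0 \<le> f u v \<and> f u v \<le> H u v - L u v) \<and>
            (\<forall>u\<in>U. (\<Sum>v\<in>V. f u v) = R u - (\<Sum>v\<in>V. L u v)) \<and>
            (\<forall>v\<in>V. (\<Sum>u\<in>U. f u v) = A v - (\<Sum>u\<in>U. L u v))"
  proof (rule capacitated_transport [OF fin])
    show "0 \<le> H u v - L u v" if "u \<in> U" "v \<in> V" for u v
      using d [OF that] c by (meson order_trans zero_le_mult_iff not_le)
    have "c * (\<Sum>u\<in>U. R u - (\<Sum>v\<in>V. L u v)) = (\<Sum>u\<in>U. \<Sum>v\<in>V. d u v)"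
      by (simp add: sum_distrib_left drow)
    also have "\<dots> = c * (\<Sum>v\<in>V. A v - (\<Sum>u\<in>U. L u v))"
      by (subst sum.swap) (simp add: sum_distrib_left dcol)
    finally show "(\<Sum>u\<in>U. R u - (\<Sum>v\<in>V. L u v)) = (\<Sum>v\<in>V. A v - (\<Sum>u\<in>U. L u v))"
      using c by simp
  next
    fix I K assume IK: "I \<subseteq> U" "K \<subseteq> V"
    have "c * (\<Sum>u\<in>I. R u - (\<Sum>v\<in>V. L u v)) = (\<Sum>u\<in>I. \<Sum>v\<in>V. d u v)"
      using IK by (auto simp: sum_distrib_left drow intro!: sum.cong)
    also have "\<dots> = (\<Sum>u\<in>I. \<Sum>v\<in>K. d u v) + (\<Sum>u\<in>I. \<Sum>v\<in>V - K. d u v)"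
      using fin IK by (simp add: sum.subset_diff [of K V] sum.distrib)
    also have "(\<Sum>u\<in>I. \<Sum>v\<in>K. d u v) \<le> (\<Sum>u\<in>I. \<Sum>v\<in>K. c * (H u v - L u v))"
      using IK d by (intro sum_mono) blast
    also have "(\<Sum>u\<in>I. \<Sum>v\<in>V - K. d u v) \<le> (\<Sum>u\<in>U. \<Sum>v\<in>V - K. d u v)"
      using IK d fin by (intro sum_mono2) (auto intro!: sum_nonneg)
    also have "\<dots> = (\<Sum>v\<in>V - K. c * (A v - (\<Sum>u\<in>U. L u v)))"
      by (subst sum.swap) (simp add: dcol)
    finally have "c * (\<Sum>u\<in>I. R u - (\<Sum>v\<in>V. L u v))
       \<le> c * ((\<Sum>u\<in>I. \<Sum>v\<in>K. H u v - L u v) + (\<Sum>v\<in>V - K. A v - (\<Sum>u\<in>U. L u v)))"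
      by (simp add: sum_distrib_left distrib_left)
    then show "(\<Sum>u\<in>I. R u - (\<Sum>v\<in>V. L u v))
       \<le> (\<Sum>u\<in>I. \<Sum>v\<in>K. H u v - L u v) + (\<Sum>v\<in>V - K. A v - (\<Sum>u\<in>U. L u v))"
      using c by simp
  qed
  then obtain f where f: "\<forall>u\<in>U. \<forall>v\<in>V. 0 \<le> f u v \<and> f u v \<le> H u v - L u v"
      "\<forall>u\<in>U. (\<Sum>v\<in>V. f u v) = R u - (\<Sum>v\<in>V. L u v)"
      "\<forall>v\<in>V. (\<Sum>u\<in>U. f u v) = A v - (\<Sum>u\<in>U. L u v)" by blast
  show ?thesis
    by (rule exI [of _ "\<lambda>u v. f u v + L u v"]) (use f in \<open>auto simp: sum.distrib algebra_simps\<close>)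
qed

section \<open>Fair splitting of a bipartite multigraph\<close>

text \<open>
  One class is extracted at a time. With \<open>c + 1\<close> classes left, the fraction \<open>w / (c + 1)\<close> satisfies
  all requirements on a class, as well as the lower bound \<open>w - c p\<close> that ensures that the remaining
  multiplicities fit into \<open>c\<close> classes; rounding it gives the class.
\<close>
lemma split_exact:
  fixes U :: "'a set" and V :: "'b set" and T :: "'t set" and w p :: "'a \<Rightarrow> 'b \<Rightarrow> int"
  assumes fin: "finite U" "finite V" and "finite T"
    and "\<And>u v. u \<in> U \<Longrightarrow> v \<in> V \<Longrightarrow> 0 \<le> w u v \<and> w u v \<le> int (card T) * p u v"
    and "\<And>u. u \<in> U \<Longrightarrow> (\<Sum>v\<in>V. w u v) = int (card T) * R u"
    and "\<And>v. v \<in> V \<Longrightarrow> (\<Sum>u\<in>U. w u v) = int (card T) * A v"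
  shows "\<exists>f. (\<forall>u\<in>U. \<forall>v\<in>V. (\<Sum>t\<in>T. f t u v) = w u v) \<and>
             (\<forall>t\<in>T. (\<forall>u\<in>U. \<forall>v\<in>V. 0 \<le> f t u v \<and> f t u v \<le> p u v) \<and>
                     (\<forall>u\<in>U. (\<Sum>v\<in>V. f t u v) = R u) \<and> (\<forall>v\<in>V. (\<Sum>u\<in>U. f t u v) = A v))"
  using assms(3-)
proof (induction T arbitrary: w)
  case empty
  then show ?case by (force intro!: exI [of _ "\<lambda>_ _ _. 0"])
next
  case (insert t T)
  define c where "c = int (card T)"
  have card: "int (card (insert t T)) = c + 1" and c: "0 \<le> c"
    using insert.hyps by (auto simp: c_def)
  have "\<exists>f. (\<forall>u\<in>U. \<forall>v\<in>V. max 0 (w u v - c * p u v) \<le> f u v \<and> f u v \<le> min (p u v) (w u v)) \<and>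
             (\<forall>u\<in>U. (\<Sum>v\<in>V. f u v) = R u) \<and> (\<forall>v\<in>V. (\<Sum>u\<in>U. f u v) = A v)"
  proof (rule integral_rounding [OF fin, where c = "c + 1"])
    fix u v assume uv: "u \<in> U" "v \<in> V"
    have w: "0 \<le> w u v" "w u v \<le> (c + 1) * p u v"
      using insert.prems(1) [OF uv] by (auto simp: card)
    have "c * w u v \<le> c * ((c + 1) * p u v)" using w(2) c by (rule mult_left_mono)
    then have "(c + 1) * (w u v - c * p u v) \<le> w u v" by (simp add: algebra_simps)
    moreover have "w u v \<le> (c + 1) * w u v" using w(1) c by (simp add: algebra_simps)
    ultimately show "(c + 1) * max 0 (w u v - c * p u v) \<le> w u v
        \<and> w u v \<le> (c + 1) * min (p u v) (w u v)"
      using w by (auto simp: max_def min_def)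
  qed (use insert.prems card c in auto)
  then obtain g where g: "\<forall>u\<in>U. \<forall>v\<in>V. max 0 (w u v - c * p u v) \<le> g u v \<and> g u v \<le> min (p u v) (w u v)"
    "\<forall>u\<in>U. (\<Sum>v\<in>V. g u v) = R u" "\<forall>v\<in>V. (\<Sum>u\<in>U. g u v) = A v" by blast
  have "\<exists>f. (\<forall>u\<in>U. \<forall>v\<in>V. (\<Sum>t\<in>T. f t u v) = w u v - g u v) \<and>
             (\<forall>t\<in>T. (\<forall>u\<in>U. \<forall>v\<in>V. 0 \<le> f t u v \<and> f t u v \<le> p u v) \<and>
                     (\<forall>u\<in>U. (\<Sum>v\<in>V. f t u v) = R u) \<and> (\<forall>v\<in>V. (\<Sum>u\<in>U. f t u v) = A v))"
  proof (rule insert.IH)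
    show "0 \<le> w u v - g u v \<and> w u v - g u v \<le> int (card T) * p u v" if "u \<in> U" "v \<in> V" for u v
      using g(1) that by (force simp: c_def)
  qed (use insert.prems g card in \<open>simp_all add: sum_subtractf c_def algebra_simps\<close>)
  then obtain f where f: "\<forall>u\<in>U. \<forall>v\<in>V. (\<Sum>t\<in>T. f t u v) = w u v - g u v"
    "\<forall>t\<in>T. (\<forall>u\<in>U. \<forall>v\<in>V. 0 \<le> f t u v \<and> f t u v \<le> p u v) \<and>
        (\<forall>u\<in>U. (\<Sum>v\<in>V. f t u v) = R u) \<and> (\<forall>v\<in>V. (\<Sum>u\<in>U. f t u v) = A v)" by blast
  have "(\<Sum>t'\<in>T. (f(t := g)) t' u v) = (\<Sum>t'\<in>T. f t' u v)" for u v
    using insert.hyps by (intro sum.cong) auto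
  then show ?case
    using f g insert.hyps by (intro exI [of _ "f(t := g)"]) auto
qed

text \<open>
  Upper bounds on the columns reduce to exact column sums by a dummy row \<open>None\<close> that fills up every
  column.
\<close>
lemma equitable_split:
  fixes U :: "'a set" and V :: "'b set" and T :: "'t set" and w p :: "'a \<Rightarrow> 'b \<Rightarrow> int"
  assumes fin: "finite U" "finite V" "finite T"
    and w: "\<And>u v. u \<in> U \<Longrightarrow> v \<in> V \<Longrightarrow> 0 \<le> w u v \<and> w u v \<le> int (card T) * p u v"
    and rows: "\<And>u. u \<in> U \<Longrightarrow> (\<Sum>v\<in>V. w u v) = int (card T) * R u"
    and cols: "\<And>v. v \<in> V \<Longrightarrow> (\<Sum>u\<in>U. w u v) \<le> int (card T) * C v"
  shows "\<exists>f. (\<forall>u\<in>U. \<forall>v\<in>V. (\<Sum>t\<in>T. f t u v) = w u v) \<and>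
             (\<forall>t\<in>T. (\<forall>u\<in>U. \<forall>v\<in>V. 0 \<le> f t u v \<and> f t u v \<le> p u v) \<and>
                     (\<forall>u\<in>U. (\<Sum>v\<in>V. f t u v) = R u) \<and> (\<forall>v\<in>V. (\<Sum>u\<in>U. f t u v) \<le> C v))"
proof -
  let ?c = "int (card T)" and ?U = "insert None (Some ` U)"
  let ?w = "\<lambda>x v. case x of Some u \<Rightarrow> w u v | None \<Rightarrow> ?c * C v - (\<Sum>u\<in>U. w u v)"
  let ?p = "\<lambda>x v. case x of Some u \<Rightarrow> p u v | None \<Rightarrow> C v"
  let ?R = "\<lambda>x. case x of Some u \<Rightarrow> R u | None \<Rightarrow> sum C V - sum R U"
  have sumU: "(\<Sum>x\<in>?U. h x) = h None + (\<Sum>u\<in>U. h (Some u))" for h :: "'a option \<Rightarrow> int"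
    using fin by (simp add: sum.reindex image_iff)
  have "(\<Sum>v\<in>V. \<Sum>u\<in>U. w u v) = ?c * sum R U"
    by (subst sum.swap) (simp add: rows sum_distrib_left)
  then have dummy: "(\<Sum>v\<in>V. ?c * C v - (\<Sum>u\<in>U. w u v)) = ?c * (sum C V - sum R U)"
    by (simp add: sum_subtractf sum_distrib_left right_diff_distrib)
  have "\<exists>f. (\<forall>u\<in>?U. \<forall>v\<in>V. (\<Sum>t\<in>T. f t u v) = ?w u v) \<and>
             (\<forall>t\<in>T. (\<forall>u\<in>?U. \<forall>v\<in>V. 0 \<le> f t u v \<and> f t u v \<le> ?p u v) \<and>
                     (\<forall>u\<in>?U. (\<Sum>v\<in>V. f t u v) = ?R u) \<and> (\<forall>v\<in>V. (\<Sum>u\<in>?U. f t u v) = C v))"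
  proof (rule split_exact)
    show "0 \<le> ?w u v \<and> ?w u v \<le> ?c * ?p u v" if "u \<in> ?U" "v \<in> V" for u v
      using that w cols by (auto intro!: sum_nonneg)
    show "(\<Sum>v\<in>V. ?w u v) = ?c * ?R u" if "u \<in> ?U" for u
      using that rows dummy by auto
    show "(\<Sum>u\<in>?U. ?w u v) = ?c * C v" for v
      by (simp add: sumU)
  qed (use fin in auto)
  then obtain f where "\<forall>u\<in>?U. \<forall>v\<in>V. (\<Sum>t\<in>T. f t u v) = ?w u v"
    "\<forall>t\<in>T. (\<forall>u\<in>?U. \<forall>v\<in>V. 0 \<le> f t u v \<and> f t u v \<le> ?p u v) \<and>
        (\<forall>u\<in>?U. (\<Sum>v\<in>V. f t u v) = ?R u) \<and> (\<forall>v\<in>V. (\<Sum>u\<in>?U. f t u v) = C v)" by blast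
  then show ?thesis
    unfolding sumU by (intro exI [of _ "\<lambda>t u. f t (Some u)"]) force
qed

section \<open>Filling a block with prescribed symbol totals\<close>

text \<open>
  When all rows have the same demand \<open>q\<close>, the worst set of rows for a given \<open>K\<close> consists of the rows
  whose demand exceeds their capacity into \<open>K\<close>. This is why truncated subtraction appears and why
  only the sets \<open>K\<close> are quantified.
\<close>
lemma filling_exists:
  fixes cap :: "'a \<Rightarrow> 'b \<Rightarrow> int"
  assumes fin: "finite U" "finite V"
    and nonneg: "\<And>u v. u \<in> U \<Longrightarrow> v \<in> V \<Longrightarrow> 0 \<le> cap u v"
    and total: "sum A V = int (card U) * q"
    and cut: "\<And>K. K \<subseteq> V \<Longrightarrow> (\<Sum>u\<in>U. monus q (\<Sum>v\<in>K. cap u v)) \<le> sum A (V - K)"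
  shows "\<exists>f. (\<forall>u\<in>U. (\<forall>v\<in>V. 0 \<le> f u v \<and> f u v \<le> cap u v) \<and> (\<Sum>v\<in>V. f u v) = q) \<and>
             (\<forall>v\<in>V. (\<Sum>u\<in>U. f u v) = A v)"
proof -
  have "\<exists>f. (\<forall>u\<in>U. \<forall>v\<in>V. 0 \<le> f u v \<and> f u v \<le> cap u v) \<and>
             (\<forall>u\<in>U. (\<Sum>v\<in>V. f u v) = q) \<and> (\<forall>v\<in>V. (\<Sum>u\<in>U. f u v) = A v)"
  proof (rule capacitated_transport [OF fin nonneg])
    fix I K assume IK: "I \<subseteq> U" "K \<subseteq> V"
    have "(\<Sum>u\<in>I. q - (\<Sum>v\<in>K. cap u v)) \<le> (\<Sum>u\<in>I. monus q (\<Sum>v\<in>K. cap u v))"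
      by (intro sum_mono) (simp add: monus_def)
    also have "\<dots> \<le> (\<Sum>u\<in>U. monus q (\<Sum>v\<in>K. cap u v))"
      using fin IK by (intro sum_mono2) (auto simp: monus_def)
    also note cut [OF IK(2)]
    finally show "(\<Sum>u\<in>I. q) \<le> (\<Sum>u\<in>I. \<Sum>v\<in>K. cap u v) + sum A (V - K)"
      by (simp add: sum_subtractf)
  qed (use total in auto)
  then show ?thesis by blast
qed

lemma filling_cut:
  fixes cap :: "'a \<Rightarrow> 'b \<Rightarrow> int"
  assumes fin: "finite V" and K: "K \<subseteq> V"
    and f: "\<forall>u\<in>U. (\<forall>v\<in>V. 0 \<le> f u v \<and> f u v \<le> cap u v) \<and> (\<Sum>v\<in>V. f u v) = q"
  shows "(\<Sum>u\<in>U. monus q (\<Sum>v\<in>K. cap u v)) \<le> (\<Sum>v\<in>V - K. \<Sum>u\<in>U. f u v)"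
proof -
  have "(\<Sum>u\<in>U. monus q (\<Sum>v\<in>K. cap u v)) \<le> (\<Sum>u\<in>U. \<Sum>v\<in>V - K. f u v)"
  proof (rule sum_mono)
    fix u assume u: "u \<in> U"
    have "q = (\<Sum>v\<in>K. f u v) + (\<Sum>v\<in>V - K. f u v)"
      using f u sum.subset_diff [OF K fin, of "f u"] by auto
    moreover have "(\<Sum>v\<in>K. f u v) \<le> (\<Sum>v\<in>K. cap u v)" "0 \<le> (\<Sum>v\<in>V - K. f u v)"
      using f u K by (auto intro!: sum_mono sum_nonneg)
    ultimately show "monus q (\<Sum>v\<in>K. cap u v) \<le> (\<Sum>v\<in>V - K. f u v)"
      by (simp add: monus_def)
  qed
  then show ?thesis by (subst sum.swap)
qed

section \<open>Outlines of squares\<close>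

text \<open>
  The inequalities between sums reflect that the \<open>n - s\<close> last columns, and the \<open>n - r\<close> last rows,
  each take a symbol at most \<open>\<lambda>\<close> times.
\<close>
definition outline ::
    "nat \<Rightarrow> nat \<Rightarrow> nat \<Rightarrow> nat \<Rightarrow> (nat \<Rightarrow> int) \<Rightarrow> nat \<Rightarrow> arr \<Rightarrow>
     (nat \<Rightarrow> nat \<Rightarrow> int) \<Rightarrow> (nat \<Rightarrow> nat \<Rightarrow> int) \<Rightarrow> (nat \<Rightarrow> int) \<Rightarrow> bool" where
  "outline r s n k rho lam M y z D \<longleftrightarrow>
     (\<forall>i\<in>{1..r}. (\<forall>l\<in>{1..k}. 0 \<le> y i l \<and> y i l \<le> row_cap s n lam M i l) \<and>
        (\<Sum>l\<in>{1..k}. y i l) = int lam * (int n - int s)) \<and>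
     (\<forall>j\<in>{1..s}. (\<forall>l\<in>{1..k}. 0 \<le> z j l \<and> z j l \<le> col_cap r n lam M j l) \<and>
        (\<Sum>l\<in>{1..k}. z j l) = int lam * (int n - int r)) \<and>
     (\<forall>l\<in>{1..k}. 0 \<le> D l \<and> D l \<le> (int n - int r) * (int n - int s)) \<and>
     (\<Sum>l\<in>{1..k}. D l) = int lam * (int n - int r) * (int n - int s) \<and>
     (\<forall>l\<in>{1..k}.
        (\<Sum>i\<in>{1..r}. y i l) + D l \<le> int lam * (int n - int s) \<and>
        (\<Sum>j\<in>{1..s}. z j l) + D l \<le> int lam * (int n - int r) \<and>
        rho l = int (occ r s M l) + (\<Sum>i\<in>{1..r}. y i l) + (\<Sum>j\<in>{1..s}. z j l) + D l)"

lemma sum_cut: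
  fixes f :: "nat \<Rightarrow> 'a::comm_monoid_add"
  assumes "m \<le> n"
  shows "sum f {1..n} = sum f {1..m} + sum f {m<..n}"
proof -
  have "{1..n} = {1..m} \<union> {m<..n}" "{1..m} \<inter> {m<..n} = {}" using assms by auto
  then show ?thesis by (metis finite_atLeastAtMost finite_greaterThanAtMost sum.union_disjoint)
qed

lemma size_eq_sum_count:
  assumes "finite S" "set_mset X \<subseteq> S"
  shows "size X = (\<Sum>l\<in>S. count X l)"
  unfolding size_multiset_overloaded_eq
  using assms by (intro sum.mono_neutral_left) (auto simp: not_in_iff)

lemma sum_int_bounded:
  fixes f :: "'a \<Rightarrow> int"
  assumes "\<And>x. x \<in> X \<Longrightarrow> f x \<le> b" "int (card X) = c"
  shows "sum f X \<le> c * b"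
  using sum_bounded_above [of X f b] assms by simp

text \<open>
  Double counting in the blocks of the square; simplicity gives the bounds by the number of cells.
\<close>
lemma outline_of_square:
  assumes rs: "r \<le> n" "s \<le> n"
    and N: "latin_square n k rho lam N" "simple_array n n k N" "extends_to r s M N"
  shows "\<exists>y z D. outline r s n k rho lam M y z D"
proof -
  define x where "x i j l = int (count (N i j) l)" for i j l
  define y where "y i l = (\<Sum>j\<in>{s<..n}. x i j l)" for i l
  define z where "z j l = (\<Sum>i\<in>{r<..n}. x i j l)" for j l
  define D where "D = (\<lambda>l. \<Sum>i\<in>{r<..n}. \<Sum>j\<in>{s<..n}. x i j l)"
  have x0: "0 \<le> x i j l" for i j l by (simp add: x_def)
  have x1: "x i j l \<le> 1" if "i \<in> {1..n}" "j \<in> {1..n}" "l \<in> {1..k}" for i j l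
    using N(2) that by (simp add: simple_array_def x_def)
  have cell: "(\<Sum>l\<in>{1..k}. x i j l) = int lam" if "i \<in> {1..n}" "j \<in> {1..n}" for i j
    using N(1) that size_eq_sum_count [of "{1..k}" "N i j"]
    by (simp add: latin_square_def lambda_matrix_def x_def)
  have row: "(\<Sum>j\<in>{1..n}. x i j l) \<le> int lam" if "i \<in> {1..n}" "l \<in> {1..k}" for i l
    using N(1) that by (simp add: latin_square_def row_occ_def x_def flip: of_nat_sum)
  have col: "(\<Sum>i\<in>{1..n}. x i j l) \<le> int lam" if "j \<in> {1..n}" "l \<in> {1..k}" for j l
    using N(1) that by (simp add: latin_square_def col_occ_def x_def flip: of_nat_sum)
  have rho: "rho l = (\<Sum>i\<in>{1..n}. \<Sum>j\<in>{1..n}. x i j l)" if "l \<in> {1..k}" for l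
    using N(1) that by (auto simp: latin_square_def occ_def x_def)
  have Mx: "int (count (M i j) l) = x i j l" if "i \<in> {1..r}" "j \<in> {1..s}" for i j l
    using N(3) that by (simp add: extends_to_def x_def)
  have rowM: "int (row_occ s M i l) = (\<Sum>j\<in>{1..s}. x i j l)" if "i \<in> {1..r}" for i l
    using Mx [OF that] by (auto simp: row_occ_def intro!: sum.cong)
  have colM: "int (col_occ r M j l) = (\<Sum>i\<in>{1..r}. x i j l)" if "j \<in> {1..s}" for j l
    using Mx [OF _ that] by (auto simp: col_occ_def intro!: sum.cong)
  have occM: "int (occ r s M l) = (\<Sum>i\<in>{1..r}. \<Sum>j\<in>{1..s}. x i j l)" for l
    using Mx by (auto simp: occ_def intro!: sum.cong)
  have A_D: "(\<Sum>i\<in>{1..r}. y i l) + D l = (\<Sum>j\<in>{s<..n}. \<Sum>i\<in>{1..n}. x i j l)" for l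
    unfolding y_def D_def by (subst sum.swap [where A = "{s<..n}"]) (simp add: sum_cut [OF rs(1), of "\<lambda>i. \<Sum>j\<in>{s<..n}. x i j l"])
  have B_D: "(\<Sum>j\<in>{1..s}. z j l) + D l = (\<Sum>i\<in>{r<..n}. \<Sum>j\<in>{1..n}. x i j l)" for l
    unfolding z_def D_def sum_cut [OF rs(2)] sum.distrib by (subst (2) sum.swap) simp
  have "outline r s n k rho lam M y z D"
    unfolding outline_def
  proof (intro conjI ballI)
    fix i l assume il: "i \<in> {1..r}" "l \<in> {1..k}"
    show "0 \<le> y i l" using x0 by (simp add: y_def sum_nonneg)
    have "y i l \<le> (int n - int s) * 1"
      unfolding y_def using il rs by (intro sum_int_bounded x1) auto
    moreover have "(\<Sum>j\<in>{1..s}. x i j l) + y i l \<le> int lam"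
      using row [of i l] il rs by (simp add: y_def sum_cut [OF rs(2)])
    ultimately show "y i l \<le> row_cap s n lam M i l"
      using il by (simp add: row_cap_def rowM)
  next
    fix j l assume jl: "j \<in> {1..s}" "l \<in> {1..k}"
    show "0 \<le> z j l" using x0 by (simp add: z_def sum_nonneg)
    have "z j l \<le> (int n - int r) * 1"
      unfolding z_def using jl rs by (intro sum_int_bounded x1) auto
    moreover have "(\<Sum>i\<in>{1..r}. x i j l) + z j l \<le> int lam"
      using col [of j l] jl rs by (simp add: z_def sum_cut [OF rs(1)])
    ultimately show "z j l \<le> col_cap r n lam M j l"
      using jl by (simp add: col_cap_def colM)
  next
    fix i assume "i \<in> {1..r}"
    then show "(\<Sum>l\<in>{1..k}. y i l) = int lam * (int n - int s)"
      unfolding y_def by (subst sum.swap) (use rs cell in simp)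
  next
    fix j assume "j \<in> {1..s}"
    then show "(\<Sum>l\<in>{1..k}. z j l) = int lam * (int n - int r)"
      unfolding z_def by (subst sum.swap) (use rs cell in simp)
  next
    fix l assume l: "l \<in> {1..k}"
    show "0 \<le> D l" using x0 by (simp add: D_def sum_nonneg)
    have "D l \<le> (int n - int r) * ((int n - int s) * 1)"
      unfolding D_def using l rs by (intro sum_int_bounded x1) auto
    then show "D l \<le> (int n - int r) * (int n - int s)" by simp
    have "(\<Sum>i\<in>{1..r}. y i l) + D l \<le> (int n - int s) * int lam"
      unfolding A_D using l rs by (intro sum_int_bounded col) auto
    then show "(\<Sum>i\<in>{1..r}. y i l) + D l \<le> int lam * (int n - int s)" by (simp add: mult.commute)
    have "(\<Sum>j\<in>{1..s}. z j l) + D l \<le> (int n - int r) * int lam"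
      unfolding B_D using l rs by (intro sum_int_bounded row) auto
    then show "(\<Sum>j\<in>{1..s}. z j l) + D l \<le> int lam * (int n - int r)" by (simp add: mult.commute)
    have "rho l = (\<Sum>i\<in>{1..r}. \<Sum>j\<in>{1..n}. x i j l) + ((\<Sum>j\<in>{1..s}. z j l) + D l)"
      unfolding B_D using rho [OF l] by (simp add: sum_cut [OF rs(1)])
    then show "rho l = int (occ r s M l) + (\<Sum>i\<in>{1..r}. y i l) + (\<Sum>j\<in>{1..s}. z j l) + D l"
      by (simp add: sum_cut [OF rs(2)] sum.distrib occM y_def)
  next
    have "(\<Sum>l\<in>{1..k}. D l) = (\<Sum>i\<in>{r<..n}. \<Sum>j\<in>{s<..n}. \<Sum>l\<in>{1..k}. x i j l)"
      unfolding D_def by (subst sum.swap) (rule sum.cong [OF refl], rule sum.swap)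
    also have "\<dots> = (\<Sum>i\<in>{r<..n}. \<Sum>j\<in>{s<..n}. int lam)"
      using cell by (intro sum.cong refl) auto
    finally show "(\<Sum>l\<in>{1..k}. D l) = int lam * (int n - int r) * (int n - int s)"
      using rs by simp
  qed
  then show ?thesis by blast
qed

text \<open>
  The merged right-hand column is split into the columns \<open>s + 1, \<dots>, n\<close>, and the merged bottom row,
  which by then has an entry in each of the \<open>n\<close> columns, into the rows \<open>r + 1, \<dots>, n\<close>. Fairness
  at the vertices puts exactly \<open>\<lambda>\<close> symbols into every new cell and at most \<open>\<lambda>\<close> copies of a symbol
  into every new line; fairness at the pairs makes the symbols of a cell distinct.
\<close>
lemma square_of_outline:
  assumes rs: "r \<le> n" "s \<le> n"
    and M: "lambda_matrix r s k lam M" "simple_array r s k M"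
    and outl: "outline r s n k rho lam M y z D"
  shows "\<exists>N. latin_square n k rho lam N \<and> simple_array n n k N \<and> extends_to r s M N"
proof -
  note outl = outl [unfolded outline_def]
  have "y i l \<le> row_cap s n lam M i l" "0 \<le> y i l" if "i \<in> {1..r}" "l \<in> {1..k}" for i l
    using outl that by blast+
  then have y: "0 \<le> y i l" "y i l \<le> int n - int s" "int (row_occ s M i l) + y i l \<le> int lam"
    if "i \<in> {1..r}" "l \<in> {1..k}" for i l
    using that by (fastforce simp: row_cap_def)+
  have ysum: "(\<Sum>l\<in>{1..k}. y i l) = int lam * (int n - int s)" if "i \<in> {1..r}" for i
    using outl that by blast
  have "z j l \<le> col_cap r n lam M j l" "0 \<le> z j l" if "j \<in> {1..s}" "l \<in> {1..k}" for j l
    using outl that by blast+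
  then have z: "0 \<le> z j l" "z j l \<le> int n - int r" "int (col_occ r M j l) + z j l \<le> int lam"
    if "j \<in> {1..s}" "l \<in> {1..k}" for j l
    using that by (fastforce simp: col_cap_def)+
  have zsum: "(\<Sum>l\<in>{1..k}. z j l) = int lam * (int n - int r)" if "j \<in> {1..s}" for j
    using outl that by blast
  have D: "0 \<le> D l" "D l \<le> (int n - int r) * (int n - int s)"
    "(\<Sum>i\<in>{1..r}. y i l) + D l \<le> int lam * (int n - int s)"
    "(\<Sum>j\<in>{1..s}. z j l) + D l \<le> int lam * (int n - int r)"
    "rho l = int (occ r s M l) + (\<Sum>i\<in>{1..r}. y i l) + (\<Sum>j\<in>{1..s}. z j l) + D l"
    if "l \<in> {1..k}" for l
    using outl that by blast+
  have Dsum: "(\<Sum>l\<in>{1..k}. D l) = int lam * (int n - int r) * (int n - int s)"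
    using outl by blast
  have sum0: "sum h {0..r} = h 0 + sum h {1..r}" for h :: "nat \<Rightarrow> int"
    by (simp add: sum.atLeast_Suc_atMost One_nat_def)

  \<comment> \<open>Row 0 stands for the merged bottom rows: it is \<open>n - r\<close> times as large as an ordinary row.\<close>
  have "\<exists>f. (\<forall>i\<in>{0..r}. \<forall>l\<in>{1..k}. (\<Sum>j\<in>{s<..n}. f j i l) = (if i = 0 then D l else y i l)) \<and>
      (\<forall>j\<in>{s<..n}.
        (\<forall>i\<in>{0..r}. \<forall>l\<in>{1..k}. 0 \<le> f j i l \<and> f j i l \<le> (if i = 0 then int n - int r else 1)) \<and>
        (\<forall>i\<in>{0..r}. (\<Sum>l\<in>{1..k}. f j i l) = (if i = 0 then int lam * (int n - int r) else int lam)) \<and>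
        (\<forall>l\<in>{1..k}. (\<Sum>i\<in>{0..r}. f j i l) \<le> int lam))"
  proof (rule equitable_split)
    fix i l assume "i \<in> {0..r}" "l \<in> {1..k}"
    then show "0 \<le> (if i = 0 then D l else y i l) \<and> (if i = 0 then D l else y i l)
        \<le> int (card {s<..n}) * (if i = 0 then int n - int r else 1)"
      using D(1,2) [of l] y(1,2) [of i l] by (auto simp: of_nat_diff rs mult.commute)
  next
    fix i assume "i \<in> {0..r}"
    then show "(\<Sum>l\<in>{1..k}. if i = 0 then D l else y i l)
        = int (card {s<..n}) * (if i = 0 then int lam * (int n - int r) else int lam)"
      using Dsum ysum [of i] by (auto simp: of_nat_diff rs mult_ac)
  next
    fix l assume "l \<in> {1..k}"
    then show "(\<Sum>i\<in>{0..r}. if i = 0 then D l else y i l) \<le> int (card {s<..n}) * int lam"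
      using D(3) [of l] by (simp add: sum0 of_nat_diff rs mult.commute add.commute)
  qed auto
  then obtain f where
    f_sum': "\<forall>i\<in>{0..r}. \<forall>l\<in>{1..k}. (\<Sum>j\<in>{s<..n}. f j i l) = (if i = 0 then D l else y i l)"
    and f: "\<forall>j\<in>{s<..n}.
        (\<forall>i\<in>{0..r}. \<forall>l\<in>{1..k}. 0 \<le> f j i l \<and> f j i l \<le> (if i = 0 then int n - int r else 1)) \<and>
        (\<forall>i\<in>{0..r}. (\<Sum>l\<in>{1..k}. f j i l) = (if i = 0 then int lam * (int n - int r) else int lam)) \<and>
        (\<forall>l\<in>{1..k}. (\<Sum>i\<in>{0..r}. f j i l) \<le> int lam)"
    by blast
  have f_sum: "(\<Sum>j\<in>{s<..n}. f j i l) = (if i = 0 then D l else y i l)"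
    if "i \<in> {0..r}" "l \<in> {1..k}" for i l
    using f_sum' that by blast
  have f_bounds: "0 \<le> f j i l" "f j i l \<le> (if i = 0 then int n - int r else 1)"
    if "j \<in> {s<..n}" "i \<in> {0..r}" "l \<in> {1..k}" for j i l
    using f that by blast+
  have f_cell: "(\<Sum>l\<in>{1..k}. f j i l) = (if i = 0 then int lam * (int n - int r) else int lam)"
    if "j \<in> {s<..n}" "i \<in> {0..r}" for j i
    using f that by blast
  have f_col: "f j 0 l + (\<Sum>i\<in>{1..r}. f j i l) \<le> int lam"
    if "j \<in> {s<..n}" "l \<in> {1..k}" for j l
    using f that unfolding sum0 by blast

  \<comment> \<open>The merged bottom row after the first splitting.\<close>
  define w where "w j l = (if j \<le> s then z j l else f j 0 l)" for j l
  have w_total: "(\<Sum>j\<in>{1..n}. w j l) = (\<Sum>j\<in>{1..s}. z j l) + D l" if "l \<in> {1..k}" for l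
    using f_sum [of 0 l] that by (simp add: sum_cut [OF rs(2)] w_def)
  have "\<exists>g. (\<forall>j\<in>{1..n}. \<forall>l\<in>{1..k}. (\<Sum>i\<in>{r<..n}. g i j l) = w j l) \<and>
      (\<forall>i\<in>{r<..n}.
        (\<forall>j\<in>{1..n}. \<forall>l\<in>{1..k}. 0 \<le> g i j l \<and> g i j l \<le> 1) \<and>
        (\<forall>j\<in>{1..n}. (\<Sum>l\<in>{1..k}. g i j l) = int lam) \<and>
        (\<forall>l\<in>{1..k}. (\<Sum>j\<in>{1..n}. g i j l) \<le> int lam))"
  proof (rule equitable_split)
    fix j l assume "j \<in> {1..n}" "l \<in> {1..k}"
    then show "0 \<le> w j l \<and> w j l \<le> int (card {r<..n}) * 1"
      using z(1,2) [of j l] f_bounds [of j 0 l] by (auto simp: of_nat_diff rs w_def)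
  next
    fix j assume "j \<in> {1..n}"
    then show "(\<Sum>l\<in>{1..k}. w j l) = int (card {r<..n}) * int lam"
      using zsum [of j] f_cell [of j 0]
      by (cases "j \<le> s") (auto simp: of_nat_diff rs w_def mult.commute)
  next
    fix l assume "l \<in> {1..k}"
    then show "(\<Sum>j\<in>{1..n}. w j l) \<le> int (card {r<..n}) * int lam"
      using D(4) [of l] w_total by (simp add: of_nat_diff rs mult.commute)
  qed auto
  then obtain g where
    g_sum': "\<forall>j\<in>{1..n}. \<forall>l\<in>{1..k}. (\<Sum>i\<in>{r<..n}. g i j l) = w j l"
    and g: "\<forall>i\<in>{r<..n}.
        (\<forall>j\<in>{1..n}. \<forall>l\<in>{1..k}. 0 \<le> g i j l \<and> g i j l \<le> 1) \<and>
        (\<forall>j\<in>{1..n}. (\<Sum>l\<in>{1..k}. g i j l) = int lam) \<and>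
        (\<forall>l\<in>{1..k}. (\<Sum>j\<in>{1..n}. g i j l) \<le> int lam)"
    by blast
  have g_sum: "(\<Sum>i\<in>{r<..n}. g i j l) = w j l" if "j \<in> {1..n}" "l \<in> {1..k}" for j l
    using g_sum' that by blast
  have g_bounds: "0 \<le> g i j l" "g i j l \<le> 1"
    if "i \<in> {r<..n}" "j \<in> {1..n}" "l \<in> {1..k}" for i j l
    using g that by blast+
  have g_cell: "(\<Sum>l\<in>{1..k}. g i j l) = int lam" if "i \<in> {r<..n}" "j \<in> {1..n}" for i j
    using g that by blast
  have g_row: "(\<Sum>j\<in>{1..n}. g i j l) \<le> int lam" if "i \<in> {r<..n}" "l \<in> {1..k}" for i l
    using g that by blast

  define X where "X i j = (if i \<le> r then f j i else g i j)" for i j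
  define N where "N i j = (if i \<le> r \<and> j \<le> s then M i j else mset_set {l\<in>{1..k}. X i j l = 1})" for i j
  define x where "x i j l = int (count (N i j) l)" for i j l
  have x_M: "x i j l = int (count (M i j) l)" if "i \<in> {1..r}" "j \<in> {1..s}" for i j l
    using that by (simp add: x_def N_def)
  have x_X: "x i j l = X i j l"
    if "i \<in> {1..n}" "j \<in> {1..n}" "\<not> (i \<le> r \<and> j \<le> s)" "l \<in> {1..k}" for i j l
  proof -
    have "0 \<le> X i j l \<and> X i j l \<le> 1"
      using f_bounds [of j i l] g_bounds [of i j l] that by (auto simp: X_def)
    then have "X i j l = 0 \<or> X i j l = 1" by linarith
    then show ?thesis using that by (auto simp: x_def N_def)
  qed
  have x_f: "x i j l = f j i l" if "i \<in> {1..r}" "j \<in> {s<..n}" "l \<in> {1..k}" for i j l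
    using x_X [of i j l] that rs by (simp add: X_def)
  have x_g: "x i j l = g i j l" if "i \<in> {r<..n}" "j \<in> {1..n}" "l \<in> {1..k}" for i j l
    using x_X [of i j l] that rs by (simp add: X_def)
  have N_set: "set_mset (N i j) \<subseteq> {1..k}" if "i \<in> {1..n}" "j \<in> {1..n}" for i j
    using M(1) that by (auto simp: N_def lambda_matrix_def)
  have cell: "size (N i j) = lam" if ij: "i \<in> {1..n}" "j \<in> {1..n}" for i j
  proof (cases "i \<le> r \<and> j \<le> s")
    case True
    then show ?thesis using M(1) ij by (simp add: N_def lambda_matrix_def)
  next
    case False
    have "int (size (N i j)) = (\<Sum>l\<in>{1..k}. x i j l)"
      using size_eq_sum_count [OF _ N_set [OF ij]] by (simp add: x_def)
    also have "\<dots> = (\<Sum>l\<in>{1..k}. X i j l)"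
      using x_X ij False by simp
    also have "\<dots> = int lam"
      using f_cell [of j i] g_cell [of i j] False ij by (auto simp: X_def)
    finally show ?thesis by simp
  qed
  have row: "(\<Sum>j\<in>{1..n}. x i j l) = int (row_occ s M i l) + y i l"
    if "i \<in> {1..r}" "l \<in> {1..k}" for i l
    using that f_sum [of i l] by (simp add: sum_cut [OF rs(2)] x_M x_f row_occ_def)
  have row': "(\<Sum>j\<in>{1..n}. x i j l) = (\<Sum>j\<in>{1..n}. g i j l)"
    if "i \<in> {r<..n}" "l \<in> {1..k}" for i l
    using that by (simp add: x_g)
  have row_le: "(\<Sum>j\<in>{1..n}. x i j l) \<le> int lam" if "i \<in> {1..n}" "l \<in> {1..k}" for i l
    using row [of i l] row' [of i l] y(3) [of i l] g_row [of i l] that by (cases "i \<le> r") auto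
  have col_le: "(\<Sum>i\<in>{1..n}. x i j l) \<le> int lam" if jl: "j \<in> {1..n}" "l \<in> {1..k}" for j l
  proof -
    have "(\<Sum>i\<in>{1..n}. x i j l) = (\<Sum>i\<in>{1..r}. x i j l) + w j l"
      using jl g_sum [of j l] by (simp add: sum_cut [OF rs(1)] x_g)
    also have "\<dots> \<le> int lam"
    proof (cases "j \<le> s")
      case True
      then show ?thesis using z(3) [of j l] jl by (simp add: x_M w_def col_occ_def)
    next
      case False
      then show ?thesis using f_col [of j l] jl by (simp add: x_f w_def)
    qed
    finally show ?thesis .
  qed
  have "(\<Sum>i\<in>{1..n}. \<Sum>j\<in>{1..n}. x i j l) = rho l" if l: "l \<in> {1..k}" for l
  proof -
    have "(\<Sum>i\<in>{r<..n}. \<Sum>j\<in>{1..n}. x i j l) = (\<Sum>j\<in>{1..n}. \<Sum>i\<in>{r<..n}. g i j l)"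
      using l by (subst sum.swap) (simp add: row')
    also have "\<dots> = (\<Sum>j\<in>{1..s}. z j l) + D l"
      using l g_sum w_total by simp
    finally show ?thesis
      using l D(5) [OF l]
      by (simp add: sum_cut [OF rs(1), of "\<lambda>i. \<Sum>j\<in>{1..n}. x i j l"] row sum.distrib occ_def row_occ_def)
  qed
  then have "latin_square n k rho lam N"
    using cell N_set row_le col_le
    by (simp add: latin_square_def lambda_matrix_def occ_def row_occ_def col_occ_def x_def flip: of_nat_sum)
  moreover have "simple_array n n k N"
    using M(2) by (auto simp: simple_array_def N_def count_mset_set')
  moreover have "extends_to r s M N"
    by (simp add: extends_to_def N_def)
  ultimately show ?thesis by blast
qed

section \<open>Outlines and simple admissibility\<close>

text \<open>
  The pairs \<open>(a l, b l)\<close> are the symbol totals of the outline reduced by \<open>\<alpha> l\<close> and \<open>\<beta> l\<close>. These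
  differences are non-negative: what a symbol \<open>l\<close> does not place in the first \<open>r\<close> rows fits into the
  \<open>n - r\<close> bottom rows, so it occurs at least \<open>\<alpha> l\<close> times top right, and similarly for \<open>\<beta> l\<close>. The conditions on single symbols express the bounds on \<open>D\<close>.
\<close>
lemma admissible_of_outline:
  assumes "lam \<le> k" "r \<le> n" "s \<le> n"
    and outl: "outline r s n k rho lam M y z D"
  shows "simply_admissible r s n k rho lam M"
proof -
  note outl = outl [unfolded outline_def]
  let ?V = "{1..k}" and ?al = "alpha r s n rho lam M" and ?be = "beta r s n rho lam M"
  define A where "A = (\<lambda>l. \<Sum>i\<in>{1..r}. y i l)"
  define B where "B = (\<lambda>l. \<Sum>j\<in>{1..s}. z j l)"
  have y: "\<forall>i\<in>{1..r}. (\<forall>l\<in>?V. 0 \<le> y i l \<and> y i l \<le> row_cap s n lam M i l) \<and>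
        (\<Sum>l\<in>?V. y i l) = int lam * (int n - int s)"
    and z: "\<forall>j\<in>{1..s}. (\<forall>l\<in>?V. 0 \<le> z j l \<and> z j l \<le> col_cap r n lam M j l) \<and>
        (\<Sum>l\<in>?V. z j l) = int lam * (int n - int r)"
    using outl by blast+
  have D: "0 \<le> D l" "D l \<le> (int n - int r) * (int n - int s)"
    "A l + D l \<le> int lam * (int n - int s)" "B l + D l \<le> int lam * (int n - int r)"
    "rho l = int (occ r s M l) + A l + B l + D l" if "l \<in> ?V" for l
    using outl that unfolding A_def B_def by blast+
  have AB0: "0 \<le> A l" "0 \<le> B l" if "l \<in> ?V" for l
    using y z that by (auto simp: A_def B_def intro!: sum_nonneg)
  define a where "a l = nat (A l - ?al l)" for l
  define b where "b l = nat (B l - ?be l)" for l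
  have a: "int (a l) = A l - ?al l" if "l \<in> ?V" for l
    using D(4,5) [OF that] AB0 [OF that] by (simp add: a_def alpha_def monus_def right_diff_distrib)
  have b: "int (b l) = B l - ?be l" if "l \<in> ?V" for l
    using D(3,5) [OF that] AB0 [OF that] by (simp add: b_def beta_def monus_def right_diff_distrib)
  have Asum: "(\<Sum>l\<in>?V. A l) = int lam * int r * (int n - int s)"
  proof -
    have "sum A ?V = (\<Sum>i\<in>{1..r}. \<Sum>l\<in>?V. y i l)"
      unfolding A_def by (rule sum.swap)
    also have "\<dots> = (\<Sum>i\<in>{1..r}. int lam * (int n - int s))"
      using y by (intro sum.cong refl) blast
    finally show ?thesis by simp
  qed
  have Bsum: "(\<Sum>l\<in>?V. B l) = int lam * int s * (int n - int r)"
  proof -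
    have "sum B ?V = (\<Sum>j\<in>{1..s}. \<Sum>l\<in>?V. z j l)"
      unfolding B_def by (rule sum.swap)
    also have "\<dots> = (\<Sum>j\<in>{1..s}. int lam * (int n - int r))"
      using z by (intro sum.cong refl) blast
    finally show ?thesis by simp
  qed
  have Acap: "A l \<le> (\<Sum>i\<in>{1..r}. row_cap s n lam M i l)" if "l \<in> ?V" for l
    unfolding A_def using y that by (intro sum_mono) blast
  have Bcap: "B l \<le> (\<Sum>j\<in>{1..s}. col_cap r n lam M j l)" if "l \<in> ?V" for l
    unfolding B_def using z that by (intro sum_mono) blast
  show ?thesis
    unfolding simply_admissible_def
  proof (rule conjI [OF \<open>lam \<le> k\<close>], rule exI [of _ a], rule exI [of _ b], intro conjI ballI allI impI)
    show "(\<Sum>l\<in>?V. int (a l)) = int lam * int r * (int n - int s) - sum ?al ?V"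
      by (simp add: a sum_subtractf Asum)
    show "(\<Sum>l\<in>?V. int (b l)) = int lam * int s * (int n - int r) - sum ?be ?V"
      by (simp add: b sum_subtractf Bsum)
  next
    fix l assume l: "l \<in> ?V"
    note ab = a [OF l] b [OF l]
    show "int (a l) \<le> (\<Sum>i\<in>{1..r}. row_cap s n lam M i l) - ?al l"
      using Acap [OF l] ab by simp
    show "int (b l) \<le> (\<Sum>j\<in>{1..s}. col_cap r n lam M j l) - ?be l"
      using Bcap [OF l] ab by simp
    show "int (a l) + int (b l) \<le> rho l - int (occ r s M l) - ?al l - ?be l"
      using D(1,5) [OF l] ab by simp
    show "rho l - int (occ r s M l) - ?al l - ?be l - (int n - int r) * (int n - int s)
        \<le> int (a l) + int (b l)"
      using D(2,5) [OF l] ab by simp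
  next
    fix i assume i: "i \<in> {1..r}"
    have "(\<Sum>l\<in>?V. y i l) \<le> (\<Sum>l\<in>?V. row_cap s n lam M i l)"
      using y i by (intro sum_mono) blast
    then show "int lam * (int n - int s) \<le> (\<Sum>l\<in>?V. row_cap s n lam M i l)"
      using y i by simp
  next
    fix j assume j: "j \<in> {1..s}"
    have "(\<Sum>l\<in>?V. z j l) \<le> (\<Sum>l\<in>?V. col_cap r n lam M j l)"
      using z j by (intro sum_mono) blast
    then show "int lam * (int n - int r) \<le> (\<Sum>l\<in>?V. col_cap r n lam M j l)"
      using z j by simp
  next
    fix K assume K: "K \<subseteq> ?V"
    have "(\<Sum>l\<in>?V - K. int (a l) + ?al l) = (\<Sum>l\<in>?V - K. A l)"
      by (intro sum.cong refl) (simp add: a)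
    then show "(\<Sum>i\<in>{1..r}. monus (int lam * (int n - int s)) (\<Sum>l\<in>K. row_cap s n lam M i l))
        \<le> (\<Sum>l\<in>?V - K. int (a l) + ?al l)"
      using filling_cut [OF _ K y] by (simp add: A_def)
    have "(\<Sum>l\<in>?V - K. int (b l) + ?be l) = (\<Sum>l\<in>?V - K. B l)"
      by (intro sum.cong refl) (simp add: b)
    then show "(\<Sum>j\<in>{1..s}. monus (int lam * (int n - int r)) (\<Sum>l\<in>K. col_cap r n lam M j l))
        \<le> (\<Sum>l\<in>?V - K. int (b l) + ?be l)"
      using filling_cut [OF _ K z] by (simp add: B_def)
  qed
qed

text \<open>
  The sets \<open>K\<close> of symbols give the cut conditions for filling the two side blocks with the totals
  \<open>a l + \<alpha> l\<close> and \<open>b l + \<beta> l\<close>; all that remains of a symbol goes to the bottom right block. The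
  summands \<open>\<alpha> l\<close> and \<open>\<beta> l\<close> are exactly what makes the remaining copies fit into the last rows and
  the last columns.
\<close>
lemma outline_of_admissible:
  assumes rs: "r \<le> n" "s \<le> n"
    and rho: "(\<Sum>l\<in>{1..k}. rho l) = int lam * (int n)^2"
    and M: "latin_rectangle r s k rho lam M"
    and adm: "simply_admissible r s n k rho lam M"
  shows "\<exists>y z D. outline r s n k rho lam M y z D"
proof -
  let ?V = "{1..k}" and ?al = "alpha r s n rho lam M" and ?be = "beta r s n rho lam M"
  obtain a b :: "nat \<Rightarrow> nat" where
    asum: "(\<Sum>l\<in>?V. int (a l)) = int lam * int r * (int n - int s) - sum ?al ?V" and
    bsum: "(\<Sum>l\<in>?V. int (b l)) = int lam * int s * (int n - int r) - sum ?be ?V" and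
    ab_le: "\<forall>l\<in>?V. int (a l) + int (b l) \<le> rho l - int (occ r s M l) - ?al l - ?be l" and
    ab_ge: "\<forall>l\<in>?V. int (a l) + int (b l) \<ge> rho l - int (occ r s M l) - ?al l - ?be l
            - (int n - int r) * (int n - int s)" and
    acut: "\<forall>K. K \<subseteq> ?V \<longrightarrow>
       (\<Sum>i\<in>{1..r}. monus (int lam * (int n - int s)) (\<Sum>l\<in>K. row_cap s n lam M i l))
         \<le> (\<Sum>l\<in>?V - K. int (a l) + ?al l)" and
    bcut: "\<forall>K. K \<subseteq> ?V \<longrightarrow>
       (\<Sum>j\<in>{1..s}. monus (int lam * (int n - int r)) (\<Sum>l\<in>K. col_cap r n lam M j l))
         \<le> (\<Sum>l\<in>?V - K. int (b l) + ?be l)"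
    using adm unfolding simply_admissible_def by (elim conjE exE) (rule that, assumption+)
  define A where "A = (\<lambda>l. int (a l) + ?al l)"
  define B where "B = (\<lambda>l. int (b l) + ?be l)"
  define D where "D = (\<lambda>l. rho l - int (occ r s M l) - A l - B l)"
  have Asum: "sum A ?V = int lam * int r * (int n - int s)"
    using asum by (simp add: A_def sum.distrib)
  have Bsum: "sum B ?V = int lam * int s * (int n - int r)"
    using bsum by (simp add: B_def sum.distrib)
  have "\<exists>y. (\<forall>i\<in>{1..r}. (\<forall>l\<in>?V. 0 \<le> y i l \<and> y i l \<le> row_cap s n lam M i l)
        \<and> (\<Sum>l\<in>?V. y i l) = int lam * (int n - int s)) \<and> (\<forall>l\<in>?V. (\<Sum>i\<in>{1..r}. y i l) = A l)"
  proof (rule filling_exists)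
    show "0 \<le> row_cap s n lam M i l" if "i \<in> {1..r}" "l \<in> ?V" for i l
      using M rs that by (simp add: latin_rectangle_def row_cap_def)
    show "sum A ?V = int (card {1..r}) * (int lam * (int n - int s))"
      using Asum by simp
    show "(\<Sum>i\<in>{1..r}. monus (int lam * (int n - int s)) (\<Sum>l\<in>K. row_cap s n lam M i l))
        \<le> sum A (?V - K)" if "K \<subseteq> ?V" for K
      using acut that unfolding A_def by blast
  qed auto
  then obtain y where y: "\<forall>i\<in>{1..r}. (\<forall>l\<in>?V. 0 \<le> y i l \<and> y i l \<le> row_cap s n lam M i l)
        \<and> (\<Sum>l\<in>?V. y i l) = int lam * (int n - int s)"
    and yA: "\<forall>l\<in>?V. (\<Sum>i\<in>{1..r}. y i l) = A l" by blast
  have "\<exists>z. (\<forall>j\<in>{1..s}. (\<forall>l\<in>?V. 0 \<le> z j l \<and> z j l \<le> col_cap r n lam M j l)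
        \<and> (\<Sum>l\<in>?V. z j l) = int lam * (int n - int r)) \<and> (\<forall>l\<in>?V. (\<Sum>j\<in>{1..s}. z j l) = B l)"
  proof (rule filling_exists)
    show "0 \<le> col_cap r n lam M j l" if "j \<in> {1..s}" "l \<in> ?V" for j l
      using M rs that by (simp add: latin_rectangle_def col_cap_def)
    show "sum B ?V = int (card {1..s}) * (int lam * (int n - int r))"
      using Bsum by simp
    show "(\<Sum>j\<in>{1..s}. monus (int lam * (int n - int r)) (\<Sum>l\<in>K. col_cap r n lam M j l))
        \<le> sum B (?V - K)" if "K \<subseteq> ?V" for K
      using bcut that unfolding B_def by blast
  qed auto
  then obtain z where z: "\<forall>j\<in>{1..s}. (\<forall>l\<in>?V. 0 \<le> z j l \<and> z j l \<le> col_cap r n lam M j l)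
        \<and> (\<Sum>l\<in>?V. z j l) = int lam * (int n - int r)"
    and zB: "\<forall>l\<in>?V. (\<Sum>j\<in>{1..s}. z j l) = B l" by blast
  have "(\<Sum>l\<in>?V. int (occ r s M l)) = (\<Sum>i\<in>{1..r}. \<Sum>j\<in>{1..s}. \<Sum>l\<in>?V. int (count (M i j) l))"
    unfolding occ_def of_nat_sum by (subst sum.swap) (rule sum.cong [OF refl], rule sum.swap)
  also have "\<dots> = (\<Sum>i\<in>{1..r}. \<Sum>j\<in>{1..s}. int lam)"
  proof (intro sum.cong refl)
    fix i j assume "i \<in> {1..r}" "j \<in> {1..s}"
    then have "size (M i j) = lam" "set_mset (M i j) \<subseteq> ?V"
      using M by (auto simp: latin_rectangle_def lambda_matrix_def)
    then show "(\<Sum>l\<in>?V. int (count (M i j) l)) = int lam"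
      using size_eq_sum_count [of ?V "M i j"] by (simp flip: of_nat_sum)
  qed
  finally have occ: "(\<Sum>l\<in>?V. int (occ r s M l)) = int lam * int r * int s" by simp
  have Dsum: "sum D ?V = int lam * (int n - int r) * (int n - int s)"
  proof -
    have "sum D ?V = sum rho ?V - (\<Sum>l\<in>?V. int (occ r s M l)) - sum A ?V - sum B ?V"
      by (simp add: D_def sum_subtractf)
    then show ?thesis
      unfolding rho Asum Bsum occ by (simp add: power2_eq_square algebra_simps)
  qed
  have "outline r s n k rho lam M y z D"
    unfolding outline_def
  proof (intro conjI ballI)
    fix l assume l: "l \<in> ?V"
    show "0 \<le> D l" "D l \<le> (int n - int r) * (int n - int s)"
      using ab_le ab_ge l by (auto simp: D_def A_def B_def algebra_simps)
    have "rho l - int (occ r s M l) + int lam * int r - int lam * int n \<le> ?al l"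
      "rho l - int (occ r s M l) + int lam * int s - int lam * int n \<le> ?be l"
      by (simp_all add: alpha_def beta_def monus_def)
    then show "(\<Sum>i\<in>{1..r}. y i l) + D l \<le> int lam * (int n - int s)"
      "(\<Sum>j\<in>{1..s}. z j l) + D l \<le> int lam * (int n - int r)"
      using yA zB l by (auto simp: D_def A_def B_def right_diff_distrib)
    show "rho l = int (occ r s M l) + (\<Sum>i\<in>{1..r}. y i l) + (\<Sum>j\<in>{1..s}. z j l) + D l"
      using yA zB l by (simp add: D_def)
  qed (use y z Dsum in auto)
  then show ?thesis by blast
qed

lemma symbols_enough:
  assumes "1 \<le> n" "latin_square n k rho lam N" "simple_array n n k N"
  shows "lam \<le> k"
proof -
  have "lam = (\<Sum>l\<in>{1..k}. count (N 1 1) l)"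
    using assms size_eq_sum_count [of "{1..k}" "N 1 1"]
    by (simp add: latin_square_def lambda_matrix_def)
  also have "\<dots> \<le> (\<Sum>l\<in>{1..k}. 1)"
    using assms by (intro sum_mono) (simp add: simple_array_def)
  finally show ?thesis by simp
qed

section \<open>The extension theorem\<close>

theorem theorem1p3:
  fixes r s n k lam :: nat and rho :: "nat \<Rightarrow> int" and M :: arr
  assumes "n \<ge> 1" and "k \<ge> 1" and "lam \<ge> 1"
    and "max r s \<le> n" and "n \<le> k"
    and "\<And>l. l \<in> {1..k} \<Longrightarrow> 1 \<le> rho l \<and> rho l \<le> int lam * int n"
    and "(\<Sum>l\<in>{1..k}. rho l) = int lam * (int n)^2"
    and "latin_rectangle r s k rho lam M" and "simple_array r s k M"
  shows "(\<exists>N. latin_square n k rho lam N \<and> simple_array n n k N \<and> extends_to r s M N)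
           \<longleftrightarrow> simply_admissible r s n k rho lam M"
proof -
  have rs: "r \<le> n" "s \<le> n" using assms(4) by auto
  show ?thesis
  proof
    assume "\<exists>N. latin_square n k rho lam N \<and> simple_array n n k N \<and> extends_to r s M N"
    then obtain N where N: "latin_square n k rho lam N" "simple_array n n k N" "extends_to r s M N"
      by blast
    then show "simply_admissible r s n k rho lam M"
      using outline_of_square [OF rs N] admissible_of_outline [OF symbols_enough rs] assms(1) by blast
  next
    assume "simply_admissible r s n k rho lam M"
    then show "\<exists>N. latin_square n k rho lam N \<and> simple_array n n k N \<and> extends_to r s M N"
      using outline_of_admissible [OF rs assms(7,8)] square_of_outline [OF rs _ assms(9)] assms(8)
      unfolding latin_rectangle_def by blast
  qed
qed

end
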